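(* Let $S^1$ be the unit circle in $\mathbb{R}^2$ and let $i : S^1\rightarrow i(S^1)\subset \mathbb{R}^2$ be a homeomorphism onto its image (not necessarily differentiable). Then there exist two points $p_1,p_2\in i(S^1)$ such that $d_{(p_1,p_2)}\circ i : S^1\to (d_{(p_1,p_2)}\circ i)(S^1)\subset\mathbb{R}^2$ is a homeomorphism onto its image.
   Context: $d(x,y)=\sqrt{\sum_{j=1}^n(x_j-y_j)^2}$ is the Euclidean distance on $\mathbb{R}^n$. For points $p_1,\ldots,p_\ell\in\mathbb{R}^n$ ($\ell\ge 1$), the distance mapping $d_{(p_1,\ldots,p_\ell)}:\mathbb{R}^n\to\mathbb{R}^\ell$ is defined by $d_{(p_1,\ldots,p_\ell)}(x)=(d(p_1,x),\ldots,d(p_\ell,x))$. Here it is used with $n=\ell=2$. *)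

theory Defs
  imports "HOL-Analysis.Analysis"
begin

(* The points p_1, ..., p_l are the rows p $ j of p; dist on real^'n is the Euclidean distance. *)
definition distance_map :: "(real ^ 'n) ^ 'l \<Rightarrow> real ^ 'n \<Rightarrow> real ^ 'l" where
  "distance_map p x = (\<chi> j. dist (p $ j) x)"

end

theory Submission
  imports Defs
begin

text \<open>
  Since the circle is compact, it is enough to find distinct points \<open>p1\<close>, \<open>p2\<close> of the Jordan curve
  \<open>C = i(S^1)\<close> such that no two distinct points of \<open>C\<close> are mirror images of each other in the line
  through \<open>p1\<close> and \<open>p2\<close>. Let \<open>K\<close> be the convex hull of \<open>C\<close>.

  If some supporting line of \<open>K\<close> contains two points of \<open>C\<close>, these will do: the whole curve lies on
  one side of the line (\<open>supporting_line_through_two_points\<close>).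

  Otherwise every supporting line meets \<open>C\<close> in a single point. Then \<open>K\<close> has interior points, and all
  its faces on supporting lines are points of \<open>C\<close>, so \<open>frontier K\<close> is contained in \<open>C\<close>
  (\<open>frontier_convex_hull_subset\<close>). By the Jordan curve theorem \<open>C\<close> is no larger than \<open>frontier K\<close>
  (\<open>sphere_within_convex_hull_eq_frontier\<close>). Now let \<open>c\<close> be an interior point of \<open>K\<close> and \<open>q\<close> a point
  of \<open>C\<close> nearest to \<open>c\<close>. The disc around \<open>c\<close> through \<open>q\<close> lies in \<open>K\<close>, and by convexity this forces
  all secants of \<open>C\<close> near \<open>q\<close> to be almost perpendicular to \<open>q - c\<close> (\<open>secant_flat\<close>); in
  particular no two such secants are perpendicular to each other. Take \<open>p1 = q\<close> and \<open>p2\<close> close to \<open>q\<close>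
  on \<open>C\<close>. If \<open>x\<close> and \<open>y\<close> in \<open>C\<close> were distinct mirror images, one of them would lie in the small cap
  that the chord cuts off on the side away from \<open>c\<close>, hence close to \<open>q\<close>; the other has the same
  distance from \<open>q\<close>. So the secants through \<open>x\<close>, \<open>y\<close> and through \<open>p1\<close>, \<open>p2\<close> are both near \<open>q\<close>, but
  perpendicular (\<open>short_chord_separates\<close>).
\<close>

section \<open>Perpendicular vectors in the plane\<close>

text \<open>Points at the same distance from \<open>x\<close> and \<open>y\<close> form the perpendicular bisector; written as the
  level set of a linear functional, it can be combined with other linear conditions.\<close>

lemma equidistant_iff:
  fixes p x y :: "'a::real_inner"
  shows "dist p x = dist p y \<longleftrightarrow> (x - y) \<bullet> p = (x \<bullet> x - y \<bullet> y) / 2"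
  by (auto simp: dist_norm norm_eq_sqrt_inner inner_diff_left inner_diff_right inner_commute)

lemma orthogonal_complement_dim2:
  fixes a b u :: "real ^ 2"
  assumes "u \<noteq> 0" "a \<noteq> 0" "u \<bullet> a = 0" "u \<bullet> b = 0"
  shows "\<exists>t. b = t *\<^sub>R a"
proof -
  have u: "u $ 1 * a $ 1 + u $ 2 * a $ 2 = 0" "u $ 1 * b $ 1 + u $ 2 * b $ 2 = 0"
    using assms by (auto simp: inner_vec_def sum_2)
  have det: "a $ 1 * b $ 2 = a $ 2 * b $ 1"
  proof -
    have "u $ 1 * (a $ 1 * b $ 2 - a $ 2 * b $ 1) = 0" "u $ 2 * (a $ 1 * b $ 2 - a $ 2 * b $ 1) = 0"
      using u by algebra+
    moreover have "u $ 1 \<noteq> 0 \<or> u $ 2 \<noteq> 0"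
      using \<open>u \<noteq> 0\<close> by (auto simp: vec_eq_iff forall_2)
    ultimately show ?thesis by auto
  qed
  consider "a $ 1 \<noteq> 0" | "a $ 2 \<noteq> 0"
    using \<open>a \<noteq> 0\<close> by (auto simp: vec_eq_iff forall_2)
  then show ?thesis
  proof cases
    case 1
    then show ?thesis using det
      by (intro exI[of _ "b $ 1 / a $ 1"]) (auto simp: vec_eq_iff forall_2 field_simps)
  next
    case 2
    then show ?thesis using det
      by (intro exI[of _ "b $ 2 / a $ 2"]) (auto simp: vec_eq_iff forall_2 field_simps)
  qed
qed

text \<open>By Pythagoras, the squared cosines of the angles that \<open>n\<close> makes with two perpendicular vectors
  add up to 1, so they cannot both be at most 1/4.\<close>

lemma orthogonal_pair_not_both_flat:
  fixes v w n :: "real ^ 2"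
  assumes "v \<noteq> 0" "w \<noteq> 0" "n \<noteq> 0" "v \<bullet> w = 0"
    and v: "\<bar>v \<bullet> n\<bar> \<le> norm v * norm n / 2" and w: "\<bar>w \<bullet> n\<bar> \<le> norm w * norm n / 2"
  shows False
proof -
  define m where "m = n - ((v \<bullet> n) / (v \<bullet> v)) *\<^sub>R v"
  have "v \<bullet> m = 0" using \<open>v \<noteq> 0\<close> by (simp add: m_def inner_diff_right)
  then obtain t where t: "m = t *\<^sub>R w"
    using orthogonal_complement_dim2 assms by blast
  define s where "s = (v \<bullet> n) / (v \<bullet> v)"
  have n: "n = s *\<^sub>R v + t *\<^sub>R w" using t by (simp add: m_def s_def algebra_simps)
  have vn: "v \<bullet> n = s * (norm v)\<^sup>2" "w \<bullet> n = t * (norm w)\<^sup>2"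
    using \<open>v \<bullet> w = 0\<close> by (auto simp: n inner_add_right power2_norm_eq_inner inner_commute)
  have "\<bar>s\<bar> * norm v \<le> norm n / 2"
    using v \<open>v \<noteq> 0\<close> unfolding vn by (simp add: abs_mult power2_eq_square field_simps)
  then have 1: "(\<bar>s\<bar> * norm v)\<^sup>2 \<le> (norm n / 2)\<^sup>2" by (intro power_mono) auto
  have "\<bar>t\<bar> * norm w \<le> norm n / 2"
    using w \<open>w \<noteq> 0\<close> unfolding vn by (simp add: abs_mult power2_eq_square field_simps)
  then have 2: "(\<bar>t\<bar> * norm w)\<^sup>2 \<le> (norm n / 2)\<^sup>2" by (intro power_mono) auto
  have "(norm n)\<^sup>2 = (\<bar>s\<bar> * norm v)\<^sup>2 + (\<bar>t\<bar> * norm w)\<^sup>2"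
    using \<open>v \<bullet> w = 0\<close>
    by (simp add: n power2_norm_eq_inner inner_add_right inner_add_left inner_commute
        power_mult_distrib power2_eq_square[of s] power2_eq_square[of t])
  moreover have "(norm n)\<^sup>2 > 0" using \<open>n \<noteq> 0\<close> by simp
  ultimately show False using 1 2 by (simp add: power_divide)
qed

section \<open>Two points of the curve on one supporting line\<close>

text \<open>The midpoint of two mirror images lies on the mirror line. If both points are on the same closed
  side of that line, they must therefore be on it, and then they coincide.\<close>

lemma supporting_line_through_two_points:
  fixes a p1 p2 :: "real ^ 2"
  assumes "a \<noteq> 0" and le: "\<And>w. w \<in> C \<Longrightarrow> a \<bullet> w \<le> b"
    and p: "p1 \<noteq> p2" "a \<bullet> p1 = b" "a \<bullet> p2 = b"
    and xy: "x \<in> C" "y \<in> C" "dist p1 x = dist p1 y" "dist p2 x = dist p2 y"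
  shows "x = y"
proof (rule ccontr)
  assume "x \<noteq> y"
  have d: "(x - y) \<bullet> p1 = (x \<bullet> x - y \<bullet> y) / 2" "(x - y) \<bullet> p2 = (x \<bullet> x - y \<bullet> y) / 2"
    using xy by (simp_all add: equidistant_iff)
  have "(p2 - p1) \<bullet> a = 0" "(p2 - p1) \<bullet> (x - y) = 0"
    using p d by (simp_all add: inner_diff_left inner_diff_right inner_commute)
  then obtain t where t: "x - y = t *\<^sub>R a"
    using orthogonal_complement_dim2[of "p2 - p1" a "x - y"] p \<open>a \<noteq> 0\<close> by auto
  have "t \<noteq> 0" using t \<open>x \<noteq> y\<close> by auto
  have "(x - y) \<bullet> (x + y - 2 *\<^sub>R p1) = 0"
    using d by (simp add: inner_diff_left inner_diff_right inner_add_right inner_commute)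
  then have "a \<bullet> (x + y - 2 *\<^sub>R p1) = 0"
    using \<open>t \<noteq> 0\<close> by (simp only: t inner_scaleR_left mult_eq_0_iff simp_thms)
  then have "a \<bullet> x + a \<bullet> y = 2 * b"
    using p by (simp add: inner_diff_right inner_add_right)
  with le[OF xy(1)] le[OF xy(2)] have "a \<bullet> (x - y) = 0" by (simp add: inner_diff_right)
  then show False using t \<open>t \<noteq> 0\<close> \<open>a \<noteq> 0\<close> by simp
qed

section \<open>Secants near a point touched by an inscribed ball\<close>

text \<open>From a point near \<open>q\<close>, a ray whose angle with \<open>c - q\<close> is less than 60 degrees is inside the
  open ball at length \<open>r / 2\<close>. If the starting point \<open>y\<close> is in \<open>K\<close>, all points of the ray up to this
  length, except perhaps \<open>y\<close>, are interior to \<open>K\<close>, so a point \<open>x\<close> off the interior cannot be among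
  them.\<close>

lemma secant_descent_bound:
  fixes c q x y :: "'a::euclidean_space"
  assumes K: "convex K" and r: "0 < r" "ball c r \<subseteq> K" and q: "norm (q - c) = r"
    and xy: "y \<in> K" "x \<notin> interior K" "x \<noteq> y" "dist q x \<le> r / 8" "dist q y \<le> r / 8"
  shows "(x - y) \<bullet> (q - c) \<ge> - (norm (x - y) * r / 2)"
proof (rule ccontr)
  assume neg: "\<not> ?thesis"
  define e where "e = sgn (x - y)"
  have ne: "norm e = 1" using \<open>x \<noteq> y\<close> by (simp add: e_def norm_sgn)
  have xe: "x - y = norm (x - y) *\<^sub>R e" using \<open>x \<noteq> y\<close> by (simp add: e_def sgn_div_norm)
  have ee: "e \<bullet> (q - c) < - (r / 2)"
  proof -
    have "norm (x - y) * (e \<bullet> (q - c)) < norm (x - y) * (- (r / 2))"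
      using neg xe by (metis inner_scaleR_left linorder_not_le mult_minus_right times_divide_eq_right)
    then show ?thesis by (rule mult_left_less_imp_less) simp
  qed
  \<comment> \<open>The step \<open>r / 2\<close> along \<open>e\<close> from \<open>q\<close> itself ends within \<open>sqrt 3 / 2 * r < 7/8 * r\<close> of \<open>c\<close>; this
    leaves the slack \<open>r / 8\<close> for starting at \<open>y\<close> instead.\<close>
  define z where "z = y + (r / 2) *\<^sub>R e"
  have "(norm ((q - c) + (r / 2) *\<^sub>R e))\<^sup>2 = r\<^sup>2 + r * (e \<bullet> (q - c)) + (r / 2)\<^sup>2"
  proof -
    have "(norm ((q - c) + (r / 2) *\<^sub>R e))\<^sup>2
        = (q - c) \<bullet> (q - c) + r * (e \<bullet> (q - c)) + (r / 2)\<^sup>2 * (e \<bullet> e)"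
      unfolding power2_norm_eq_inner inner_add_left inner_add_right inner_scaleR_left inner_scaleR_right
      by (simp add: inner_commute[of "q - c" e] power2_eq_square field_simps)
    then show ?thesis using ne q by (simp flip: power2_norm_eq_inner)
  qed
  also have "\<dots> < r\<^sup>2 + r * (- (r / 2)) + (r / 2)\<^sup>2"
    using mult_strict_left_mono[OF ee r(1)] by simp
  also have "\<dots> \<le> (7 / 8 * r)\<^sup>2" using r by (simp add: power2_eq_square field_simps)
  finally have "norm ((q - c) + (r / 2) *\<^sub>R e) < 7 / 8 * r"
    by (rule power2_less_imp_less) (use r in simp)
  moreover have "norm (z - c) \<le> norm ((q - c) + (r / 2) *\<^sub>R e) + norm (y - q)"
    using norm_triangle_ineq[of "(q - c) + (r / 2) *\<^sub>R e" "y - q"] by (simp add: z_def algebra_simps)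
  moreover have "norm (y - q) \<le> r / 8" using xy by (simp add: dist_norm norm_minus_commute)
  ultimately have "norm (z - c) < r" by linarith
  then have "z \<in> ball c r" by (simp add: dist_norm norm_minus_commute)
  then have zi: "z \<in> interior K" using r interior_maximal open_ball by blast
  have "norm (x - y) \<le> r / 4" using xy dist_triangle3[of x y q] by (simp add: dist_norm)
  then have u: "0 < norm (x - y) / (r / 2)" "norm (x - y) / (r / 2) < 1"
    using r \<open>x \<noteq> y\<close> by auto
  have "x = (1 - norm (x - y) / (r / 2)) *\<^sub>R y + (norm (x - y) / (r / 2)) *\<^sub>R z"
    using xe r by (simp add: z_def algebra_simps)
  moreover have "z \<noteq> y" using ne r by (auto simp: z_def)
  ultimately have "x \<in> open_segment y z" using u by (auto simp: in_segment)
  then show False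
    using in_interior_closure_convex_segment[OF K zi, of y] xy closure_subset[of K]
    by (auto simp: open_segment_commute)
qed

lemma secant_flat:
  fixes c q x y :: "'a::euclidean_space"
  assumes K: "convex K" and r: "0 < r" "ball c r \<subseteq> K" and q: "norm (q - c) = r"
    and xy: "x \<in> K - interior K" "y \<in> K - interior K" "dist q x \<le> r / 8" "dist q y \<le> r / 8"
  shows "\<bar>(x - y) \<bullet> (q - c)\<bar> \<le> norm (x - y) * norm (q - c) / 2"
proof (cases "x = y")
  case False
  have "(x - y) \<bullet> (q - c) \<ge> - (norm (x - y) * r / 2)"
    using secant_descent_bound[OF K r q, of y x] xy False by auto
  moreover have "(y - x) \<bullet> (q - c) \<ge> - (norm (y - x) * r / 2)"
    using secant_descent_bound[OF K r q, of x y] xy False by auto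
  moreover have "(y - x) \<bullet> (q - c) = - ((x - y) \<bullet> (q - c))" by (simp add: inner_diff_left)
  ultimately show ?thesis
    using q by (simp only: abs_le_iff norm_minus_commute[of y x]) linarith
qed auto

section \<open>A short chord near the touching point\<close>

text \<open>The point \<open>z\<close> lies between \<open>q\<close> and \<open>p\<close>, since otherwise \<open>p\<close> or \<open>q\<close> would be strictly between
  an interior point and a point of \<open>K\<close>, and hence interior.\<close>

lemma collinear_with_interior_between:
  fixes z q p :: "'a::euclidean_space"
  assumes K: "convex K" and z: "z \<in> interior K" and q: "q \<in> K - interior K" and p: "p \<in> K - interior K"
    and t: "z - q = t *\<^sub>R (p - q)"
  shows "norm (z - q) \<le> norm (p - q)"
proof -
  have zz: "z = (1 - t) *\<^sub>R q + t *\<^sub>R p" using t by (simp add: algebra_simps)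
  have ne: "z \<noteq> q" "z \<noteq> p" using z q p by auto
  have "\<not> t > 1"
  proof
    assume "t > 1"
    then have "p = (1 - (1 - 1 / t)) *\<^sub>R z + (1 - 1 / t) *\<^sub>R q"
      by (simp add: zz algebra_simps)
    then have "p \<in> open_segment z q"
      using ne \<open>t > 1\<close> by (auto simp: in_segment intro!: exI[of _ "1 - 1/t"])
    then show False
      using in_interior_closure_convex_segment[OF K z, of q] q p closure_subset[of K] by auto
  qed
  moreover have "\<not> t < 0"
  proof
    assume "t < 0"
    have "(1 - t) *\<^sub>R q = z - t *\<^sub>R p" by (simp add: zz)
    then have "q = (1 / (1 - t)) *\<^sub>R (z - t *\<^sub>R p)" using \<open>t < 0\<close>
      by (metis add.inverse_inverse diff_gt_0_iff_gt less_trans less_numeral_extra(1) less_irrefl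
          nonzero_divide_eq_eq scaleR_one scaleR_scaleR)
    then have "q = (1 - (- t / (1 - t))) *\<^sub>R z + (- t / (1 - t)) *\<^sub>R p"
      using \<open>t < 0\<close> by (simp add: algebra_simps divide_simps)
    moreover have "0 < - t / (1 - t)" "- t / (1 - t) < 1" using \<open>t < 0\<close> by (auto simp: field_simps)
    ultimately have "q \<in> open_segment z p"
      using ne(2) unfolding in_segment by blast
    then show False
      using in_interior_closure_convex_segment[OF K z, of p] q p closure_subset[of K] by auto
  qed
  ultimately have "\<bar>t\<bar> * norm (p - q) \<le> 1 * norm (p - q)" by (intro mult_right_mono) auto
  then show ?thesis by (simp add: t)
qed

text \<open>Shrinking the ball towards \<open>x\<close> gives a ball in \<open>K\<close> around each point of the segment from \<open>c\<close> to
  \<open>x\<close>. This quantifies how far \<open>x\<close> can be beyond such a point when that point is close to the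
  boundary point \<open>q\<close>.\<close>

lemma depth_along_ray:
  fixes c x q :: "'a::euclidean_space"
  assumes K: "convex K" and r: "ball c r \<subseteq> K" "x \<in> K" and q: "q \<notin> interior K"
    and t: "0 \<le> t" "t < 1" 
  shows "(1 - t) * r \<le> dist q ((1 - t) *\<^sub>R c + t *\<^sub>R x)"
proof (rule ccontr)
  define z where "z = (1 - t) *\<^sub>R c + t *\<^sub>R x"
  assume "\<not> ?thesis"
  then have "q \<in> ball z ((1 - t) * r)" by (simp add: z_def dist_commute)
  moreover have "ball z ((1 - t) * r) \<subseteq> K"
  proof
    fix w assume w: "w \<in> ball z ((1 - t) * r)"
    define b where "b = (1 / (1 - t)) *\<^sub>R (w - z)"
    have wb: "w - z = (1 - t) *\<^sub>R b" using t by (simp add: b_def)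
    have "(1 - t) * norm b < (1 - t) * r"
      using w wb t by (simp add: dist_norm norm_minus_commute)
    then have "norm b < r" using t by (simp add: mult_less_cancel_left)
    then have "c + b \<in> K" using r by (auto simp: dist_norm)
    moreover have "w = (1 - t) *\<^sub>R (c + b) + t *\<^sub>R x"
      using wb by (simp add: z_def algebra_simps)
    ultimately show "w \<in> K" using K r t by (auto simp: convex_alt)
  qed
  ultimately show False using q interior_maximal open_ball by blast
qed

text \<open>The bound on the length of the chord from \<open>q\<close> to \<open>p\<close> is chosen so that the cap cut off by the
  chord on the side away from \<open>c\<close> stays within \<open>r / 8\<close> of \<open>q\<close>, the radius in which secants are flat.
  A secant perpendicular to the chord cannot be flat as well.\<close>

lemma short_chord_separates:
  fixes c q p :: "real ^ 2"
  assumes K: "convex K" and r: "0 < r" "ball c r \<subseteq> K" and q: "norm (q - c) = r" "q \<in> K - interior K"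
    and M: "0 \<le> M" "\<And>x. x \<in> K \<Longrightarrow> dist c x \<le> M"
    and p: "p \<in> K - interior K" "p \<noteq> q" "dist q p \<le> r\<^sup>2 / (8 * (M + r))"
    and xy: "x \<in> K - interior K" "y \<in> K - interior K" "dist q x = dist q y" "dist p x = dist p y"
  shows "x = y"
proof (rule ccontr)
  assume "x \<noteq> y"
  define k where "k = (x \<bullet> x - y \<bullet> y) / 2"
  define \<delta> where "\<delta> = dist q p"
  have d: "(x - y) \<bullet> q = k" "(x - y) \<bullet> p = k"
    using xy by (simp_all add: equidistant_iff k_def)
  have dl: "\<delta> * (M + r) \<le> r * (r / 8)"
    using p(3) r M unfolding \<delta>_def by (simp add: field_simps power2_eq_square)
  have "\<delta> * r \<le> \<delta> * (M + r)" using M by (auto simp: \<delta>_def intro!: mult_left_mono)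
  with dl have "\<delta> * r \<le> r / 8 * r" by (simp add: mult.commute)
  then have pq: "dist q p \<le> r / 8" using r unfolding \<delta>_def by (simp add: mult_le_cancel_right)
  have on_line: "\<exists>t. w - q = t *\<^sub>R (p - q)" if "(x - y) \<bullet> w = k" for w
    using orthogonal_complement_dim2[of "x - y" "p - q" "w - q"] that d \<open>x \<noteq> y\<close> p
    by (auto simp: inner_diff_right)
  have flat_chord: "\<bar>(p - q) \<bullet> (q - c)\<bar> \<le> norm (p - q) * norm (q - c) / 2"
    using secant_flat[OF K r q(1)] p q pq r by auto
  \<comment> \<open>The line through the flat chord is not the radial line at \<open>q\<close>, so it has \<open>c\<close> strictly on one side.\<close>
  have c_off: "(x - y) \<bullet> c \<noteq> k"
  proof
    assume "(x - y) \<bullet> c = k"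
    then obtain t where t: "c - q = t *\<^sub>R (p - q)" using on_line by blast
    then have t': "q - c = (- t) *\<^sub>R (p - q)" by (metis minus_diff_eq scaleR_minus_left)
    have "norm (p - q) > 0" "\<bar>t\<bar> * norm (p - q) > 0" using p t' q r by auto
    then have "0 < \<bar>t\<bar> * norm (p - q) * norm (p - q)" by simp
    then show False using flat_chord unfolding t'
      by (simp add: abs_mult power2_eq_square flip: power2_norm_eq_inner)
  qed
  \<comment> \<open>The cap is small: the segment from \<open>c\<close> to a point \<open>u\<close> of the cap crosses the chord at \<open>z\<close>, which
    is close to the boundary point \<open>q\<close>, so \<open>u\<close> is only slightly beyond \<open>z\<close>.\<close>
  have near: "dist q u \<le> r / 8"
    if u: "u \<in> K" and opp: "((x - y) \<bullet> u - k) * ((x - y) \<bullet> c - k) < 0" for u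
  proof -
    define A where "A = (x - y) \<bullet> u - k"
    define B where "B = (x - y) \<bullet> c - k"
    define t where "t = B / (B - A)"
    have AB: "A * B < 0" using opp by (simp add: A_def B_def)
    then have "B \<noteq> A" by (auto simp: not_square_less_zero)
    have t: "0 < t" "t < 1"
      using AB unfolding t_def by (auto simp: mult_less_0_iff field_simps)
    define z where "z = (1 - t) *\<^sub>R c + t *\<^sub>R u"
    have "(x - y) \<bullet> z - k = (1 - t) * B + t * A"
      by (simp add: z_def A_def B_def inner_add_right algebra_simps)
    also have "\<dots> = B - t * (B - A)" by (simp add: algebra_simps)
    also have "\<dots> = 0" using \<open>B \<noteq> A\<close> by (simp add: t_def)
    finally obtain s where s: "z - q = s *\<^sub>R (p - q)" using on_line[of z] by auto
    have ci: "c \<in> interior K" using r interior_maximal[OF r(2)] by auto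
    have "u \<noteq> c" using opp by (auto simp: not_square_less_zero)
    then have "z \<in> open_segment c u" using t by (auto simp: in_segment z_def)
    then have zi: "z \<in> interior K"
      using in_interior_closure_convex_segment[OF K ci, of u] u closure_subset[of K] by auto
    have zq: "dist q z \<le> \<delta>"
      using collinear_with_interior_between[OF K zi q(2) p(1) s]
      by (simp add: \<delta>_def dist_norm norm_minus_commute)
    have "(1 - t) * r \<le> \<delta>"
      using depth_along_ray[OF K r(2) u, of q t] q t zq by (auto simp: z_def)
    moreover have "dist z u = (1 - t) * dist c u"
    proof -
      have "z - u = (1 - t) *\<^sub>R (c - u)" by (simp add: z_def algebra_simps)
      then show ?thesis using t by (simp add: dist_norm)
    qed
    ultimately have "r * dist z u \<le> \<delta> * M"
      using M(2)[OF u] t r M(1)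
      by (smt (verit) mult.assoc mult.commute mult_mono zero_le_dist mult_nonneg_nonneg)
    then have "r * dist q u \<le> \<delta> * M + \<delta> * r"
      using dist_triangle[of q u z] zq r
      by (smt (verit) distrib_left mult.commute mult_left_mono)
    then have "r * dist q u \<le> r * (r / 8)" using dl by (simp add: distrib_left)
    then show ?thesis using r by (simp add: mult_le_cancel_left)
  qed
  \<comment> \<open>The points \<open>x\<close> and \<open>y\<close> are on opposite sides of their bisector, so one of them is in the cap.\<close>
  have gx: "(x - y) \<bullet> x - k = (x - y) \<bullet> (x - y) / 2" "(x - y) \<bullet> y - k = - ((x - y) \<bullet> (x - y) / 2)"
    by (simp_all add: k_def inner_diff_left inner_diff_right inner_commute field_simps)
  have pos: "(x - y) \<bullet> (x - y) / 2 > 0" using \<open>x \<noteq> y\<close> by simp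
  have "dist q x \<le> r / 8"
  proof (cases "(x - y) \<bullet> c < k")
    case True
    then show ?thesis using near[of x] xy pos unfolding gx by (auto simp: mult_less_0_iff)
  next
    case False
    then have "dist q y \<le> r / 8"
      using near[of y] c_off xy pos unfolding gx by (auto simp: mult_less_0_iff)
    then show ?thesis using xy by simp
  qed
  then have "\<bar>(x - y) \<bullet> (q - c)\<bar> \<le> norm (x - y) * norm (q - c) / 2"
    using secant_flat[OF K r q(1) xy(1,2)] xy(3) by simp
  then show False
    using orthogonal_pair_not_both_flat[of "x - y" "p - q" "q - c"] flat_chord \<open>x \<noteq> y\<close> p q r d
    by (auto simp: inner_diff_right)
qed

section \<open>Strictly convex curves\<close>

text \<open>A boundary point of the hull lies on a supporting hyperplane, and the corresponding face is the
  hull of points of \<open>C\<close>. If each such hyperplane meets \<open>C\<close> only once, the face is a single point of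
  \<open>C\<close>.\<close>

lemma frontier_convex_hull_subset:
  fixes C :: "'a::euclidean_space set"
  assumes C: "compact C"
    and single: "\<And>a b p1 p2. \<lbrakk>a \<noteq> 0; \<forall>w\<in>C. a \<bullet> w \<le> b; p1 \<in> C; p2 \<in> C; a \<bullet> p1 = b; a \<bullet> p2 = b\<rbrakk> \<Longrightarrow> p1 = p2"
    and ne: "interior (convex hull C) \<noteq> {}"
  shows "frontier (convex hull C) \<subseteq> C"
proof
  fix z assume z: "z \<in> frontier (convex hull C)"
  have cl: "closed (convex hull C)" using C compact_convex_hull compact_imp_closed by blast
  then have zK: "z \<in> convex hull C" using z frontier_subset_closed by blast
  have "z \<notin> rel_interior (convex hull C)"
    using z ne rel_interior_nonempty_interior[OF ne] by (auto simp: frontier_def)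
  then obtain a where a: "a \<noteq> 0" "\<And>y. y \<in> convex hull C \<Longrightarrow> a \<bullet> z \<le> a \<bullet> y"
    using supporting_hyperplane_rel_boundary[OF convex_convex_hull zK] by metis
  have "(convex hull C \<inter> {x. a \<bullet> x = a \<bullet> z}) face_of (convex hull C)"
    using a by (intro face_of_Int_supporting_hyperplane_ge) auto
  then obtain S where S: "S \<subseteq> C" "convex hull C \<inter> {x. a \<bullet> x = a \<bullet> z} = convex hull S"
    using face_of_convex_hull_subset[OF C] by metis
  have "S \<noteq> {}" using S(2) zK by auto
  then obtain s where s: "s \<in> S" by auto
  have "s' = s" if "s' \<in> S" for s'
  proof (rule single[of "- a" "- (a \<bullet> z)"])
    show "\<forall>w\<in>C. - a \<bullet> w \<le> - (a \<bullet> z)" using a(2) by (auto simp: hull_inc)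
    have "u \<in> convex hull S" if "u \<in> S" for u using that by (simp add: hull_inc)
    then have "a \<bullet> u = a \<bullet> z" if "u \<in> S" for u using S(2) that by blast
    then show "- a \<bullet> s' = - (a \<bullet> z)" "- a \<bullet> s = - (a \<bullet> z)" using that s by auto
  qed (use a S s that in auto)
  then have "S = {s}" using s by blast
  moreover have "z \<in> convex hull S" using S(2) zK by blast
  ultimately show "z \<in> C" using s S(1) by simp
qed

text \<open>A component \<open>T\<close> of the complement of \<open>C\<close> that leaves the hull cannot cross the boundary of the
  hull, so it stays outside. By the Jordan-Brouwer theorem every point of \<open>C\<close> is in the frontier of
  \<open>T\<close>, and therefore is not interior to the hull.\<close>

lemma sphere_within_convex_hull_eq_frontier:
  fixes C :: "'a::euclidean_space set"
  assumes C: "C homeomorphic sphere (a::'a) r" "compact C" "2 \<le> DIM('a)"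
    and sub: "frontier (convex hull C) \<subseteq> C"
  shows "frontier (convex hull C) = C"
proof -
  let ?K = "convex hull C"
  have "compact ?K" using C compact_convex_hull by blast
  then have "?K \<noteq> UNIV" using not_compact_UNIV by metis
  then obtain w where w: "w \<notin> ?K" by auto
  then have "w \<in> - C" by (auto dest: hull_inc)
  then obtain T where T: "T \<in> components (- C)" "w \<in> T" using Union_components[of "- C"] by blast
  have fT: "frontier T = C" using Jordan_Brouwer_frontier[OF C(1) T(1) C(3)] .
  have "T \<inter> frontier ?K = {}" using in_components_subset[OF T(1)] sub by blast
  then have "T \<inter> ?K = {}"
    using connected_Int_frontier[OF in_components_connected[OF T(1)], of ?K] T w by blast
  then have "closure T \<subseteq> - interior ?K" by (metis closure_complement closure_mono disjoint_eq_subset_Compl)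
  then have "C \<inter> interior ?K = {}" using fT by (auto simp: frontier_def)
  then have "C \<subseteq> frontier ?K"
    using closure_subset[of ?K] by (auto simp: frontier_def hull_inc)
  then show ?thesis using sub by blast
qed

lemma interior_convex_hull_nonempty:
  fixes C :: "'a::euclidean_space set"
  assumes single: "\<And>a b p1 p2. \<lbrakk>a \<noteq> 0; \<forall>w\<in>C. a \<bullet> w \<le> b; p1 \<in> C; p2 \<in> C; a \<bullet> p1 = b; a \<bullet> p2 = b\<rbrakk> \<Longrightarrow> p1 = p2"
    and two: "p1 \<in> C" "p2 \<in> C" "p1 \<noteq> p2"
  shows "interior (convex hull C) \<noteq> {}"
proof
  assume "interior (convex hull C) = {}"
  then obtain a b where "a \<noteq> 0" "convex hull C \<subseteq> {x. a \<bullet> x = b}"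
    using empty_interior_subset_hyperplane[OF convex_convex_hull] by metis
  then have "\<forall>w\<in>C. a \<bullet> w = b" by (auto dest: hull_inc)
  then show False using single[of a b p1 p2] \<open>a \<noteq> 0\<close> two by auto
qed

section \<open>The resolving pair\<close>

lemma Jordan_curve_resolving_pair:
  fixes C :: "(real ^ 2) set"
  assumes C: "C homeomorphic sphere (0 :: real ^ 2) 1"
  shows "\<exists>p1\<in>C. \<exists>p2\<in>C. p1 \<noteq> p2 \<and>
    (\<forall>x\<in>C. \<forall>y\<in>C. dist p1 x = dist p1 y \<and> dist p2 x = dist p2 y \<longrightarrow> x = y)"
proof (cases "\<exists>a b. a \<noteq> 0 \<and> (\<forall>w\<in>C. a \<bullet> w \<le> b) \<and> (\<exists>p1\<in>C. \<exists>p2\<in>C. p1 \<noteq> p2 \<and> a \<bullet> p1 = b \<and> a \<bullet> p2 = b)")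
  case True
  then obtain a b p1 p2 where h: "a \<noteq> 0" "\<forall>w\<in>C. a \<bullet> w \<le> b" "p1 \<in> C" "p2 \<in> C" "p1 \<noteq> p2"
      "a \<bullet> p1 = b" "a \<bullet> p2 = b" by blast
  show ?thesis
    using supporting_line_through_two_points[of a C b p1 p2] h by blast
next
  case False
  then have single: "p1 = p2"
    if "a \<noteq> 0" "\<forall>w\<in>C. a \<bullet> w \<le> b" "p1 \<in> C" "p2 \<in> C" "a \<bullet> p1 = b" "a \<bullet> p2 = b" for a b p1 p2
    using that by blast
  have cC: "compact C" using C homeomorphic_compactness compact_sphere by blast
  have conn: "connected C"
    using C homeomorphic_connectedness connected_sphere[of "0 :: real^2" 1] by auto
  have not_sing: "C \<noteq> {u}" for u
  proof
    assume "C = {u}"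
    then obtain f where "sphere (0 :: real ^ 2) 1 = f ` {u}"
      using C unfolding homeomorphic_def homeomorphism_def by metis
    moreover have "axis 1 1 \<in> sphere (0 :: real ^ 2) 1" "- axis 1 1 \<in> sphere (0 :: real ^ 2) 1"
      by simp_all
    ultimately have "axis 1 1 = - (axis 1 1 :: real ^ 2)" by simp
    then show False by (simp add: vec_eq_iff forall_2 axis_def)
  qed
  have "C \<noteq> {}" using C by (auto simp: homeomorphic_empty)
  then obtain u v where uv: "u \<in> C" "v \<in> C" "u \<noteq> v" using not_sing by blast
  define K where "K = convex hull C"
  have Kc: "convex K" "compact K" using cC compact_convex_hull by (auto simp: K_def)
  have iK: "interior K \<noteq> {}"
    unfolding K_def using single uv by (rule interior_convex_hull_nonempty)
  have fK: "frontier K = C"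
    unfolding K_def
    using sphere_within_convex_hull_eq_frontier[OF C cC] frontier_convex_hull_subset[OF cC] single iK
    by (simp add: K_def)
  have CK: "C = K - interior K"
    using fK compact_imp_closed[OF Kc(2)] by (simp add: frontier_def)
  obtain c where c: "c \<in> interior K" using iK by blast
  obtain q where q: "q \<in> C" "\<And>y. y \<in> C \<Longrightarrow> dist c q \<le> dist c y"
    using distance_attains_inf[OF compact_imp_closed[OF cC] \<open>C \<noteq> {}\<close>] by metis
  define r where "r = dist c q"
  have r: "r > 0" using c q CK by (auto simp: r_def)
  have bK: "ball c r \<subseteq> K"
  proof (rule ccontr)
    assume "\<not> ball c r \<subseteq> K"
    moreover have "c \<in> ball c r \<inter> K" using r c interior_subset by auto
    ultimately have "ball c r \<inter> frontier K \<noteq> {}"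
      by (intro connected_Int_frontier) blast+
    then show False using q fK by (force simp: r_def)
  qed
  obtain M where M: "\<And>x. x \<in> K \<Longrightarrow> dist c x \<le> M"
    using compact_imp_bounded[OF Kc(2)] by (auto simp: bounded_any_center[of _ c])
  have M0: "0 \<le> M" using M[of c] c interior_subset by auto
  have "q islimpt C" using connected_imp_perfect[OF conn q(1) not_sing] .
  moreover have "r\<^sup>2 / (8 * (M + r)) > 0" using r M0 by simp
  ultimately obtain p where p: "p \<in> C" "p \<noteq> q" "dist p q < r\<^sup>2 / (8 * (M + r))"
    unfolding islimpt_approachable by blast
  have "norm (q - c) = r" by (simp add: r_def dist_norm norm_minus_commute)
  note * = short_chord_separates[OF Kc(1) r bK this _ M0 M, of p, folded CK, OF q(1) _ p(1) p(2)]
  have "dist q p \<le> r\<^sup>2 / (8 * (M + r))" using p(3) by (simp add: dist_commute)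
  then have "\<forall>x\<in>C. \<forall>y\<in>C. dist q x = dist q y \<and> dist p x = dist p y \<longrightarrow> x = y" using * by blast
  then show ?thesis using p q(1) by metis
qed

theorem proposition1p1:
  fixes i :: "real ^ 2 \<Rightarrow> real ^ 2"
  assumes "\<exists>g. homeomorphism (sphere 0 1) (i ` sphere 0 1) i g"
  shows "\<exists>p1 \<in> i ` sphere 0 1. \<exists>p2 \<in> i ` sphere 0 1. p1 \<noteq> p2 \<and>
    (\<exists>h. homeomorphism (sphere 0 1) ((distance_map (vector [p1, p2] :: (real ^ 2) ^ 2) \<circ> i) ` sphere 0 1)
           (distance_map (vector [p1, p2]) \<circ> i) h)"
proof -
  obtain g where g: "homeomorphism (sphere 0 1) (i ` sphere 0 1) i g" using assms by blast
  then have "i ` sphere 0 1 homeomorphic sphere (0 :: real ^ 2) 1"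
    using homeomorphic_def homeomorphic_sym by blast
  then obtain p1 p2 where p: "p1 \<in> i ` sphere 0 1" "p2 \<in> i ` sphere 0 1" "p1 \<noteq> p2"
    and sep: "\<forall>x \<in> i ` sphere 0 1. \<forall>y \<in> i ` sphere 0 1. dist p1 x = dist p1 y \<and> dist p2 x = dist p2 y \<longrightarrow> x = y"
    by (meson Jordan_curve_resolving_pair)
  let ?d = "distance_map (vector [p1, p2] :: (real ^ 2) ^ 2)"
  have "continuous_on (sphere 0 1) (?d \<circ> i)"
  proof -
    have "continuous_on (sphere 0 1) (\<lambda>x. dist p (i x))" for p
      by (rule continuous_on_dist[OF continuous_on_const homeomorphism_cont1[OF g]])
    then have "continuous_on (sphere 0 1) (\<lambda>x. \<chi> j. dist ((vector [p1, p2] :: (real ^ 2) ^ 2) $ j) (i x))"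
      by (rule continuous_on_vec_lambda)
    then show ?thesis by (simp add: comp_def distance_map_def)
  qed
  moreover have "inj_on (?d \<circ> i) (sphere 0 1)"
  proof (rule comp_inj_on)
    show "inj_on i (sphere 0 1)" by (rule inj_on_inverseI[where g = g]) (rule homeomorphism_apply1[OF g])
    show "inj_on ?d (i ` sphere 0 1)"
    proof (rule inj_onI)
      fix x y
      assume "x \<in> i ` sphere 0 1" "y \<in> i ` sphere 0 1" "?d x = ?d y"
      moreover from this(3) have "dist p1 x = dist p1 y \<and> dist p2 x = dist p2 y"
        by (simp add: distance_map_def vec_eq_iff forall_2)
      ultimately show "x = y" using sep by blast
    qed
  qed
  ultimately have "\<exists>h. homeomorphism (sphere 0 1) ((?d \<circ> i) ` sphere 0 1) (?d \<circ> i) h"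
    by (intro homeomorphism_compact) auto
  then show ?thesis using p by blast
qed

end
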